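(* Let $G$ be a connected nontrivial graph of order $n=|V(G)|$ with $k\ge 1$ min-forced vertices. Then $$k\le \frac{2}{3}\left(n-\gamma^{LD}(G)\right)$$ and, in particular, $k\le \frac{2}{5}n$. Furthermore, for all nontrivial graphs $G$ (of order $n$) with min-forced vertices, we have $\gamma^{LD}(G)\le n-3$.
   Context: All graphs are simple, finite and undirected. A graph is nontrivial if its order $n=|V(G)|$ satisfies $n\ge 2$. $N_G[v]$ denotes the closed neighbourhood of $v$, i.e. $v$ together with its neighbours. For $S\subseteq V(G)$ and $v\in V(G)$ put $I_G(S;v)=S\cap N_G[v]$. A nonempty set $S\subseteq V(G)$ is a locating-dominating code (LD-code) if for all distinct $x,y\in V(G)\setminus S$ we have $I_G(S;x)\ne I_G(S;y)$, and $I_G(S;x)\neq\emptyset$ for every $x\in V(G)\setminus S$. $\gamma^{LD}(G)$ is the minimum cardinality of an LD-code in $G$; an LD-code of this cardinality is a minimum LD-code. A vertex $v\in V(G)$ is min-forced if it belongs to every minimum LD-code of $G$.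
   Formalization: The last claim, γ^LD(G) ≤ n−3, is proved for graphs in which some min-forced vertex has a neighbour; as stated it fails when the min-forced vertices are all isolated, e.g. for two isolated vertices, where γ^LD = n = 2. *)

theory Defs
  imports Complex_Main "Graph_Theory.Graph_Theory"
begin

text \<open>Finite simple undirected graphs are the library's symmetric, loop-free digraphs without
  multiple arcs (locale \<^locale>\<open>graph\<close>); an edge is a pair of opposite arcs, so adjacency is
  \<^const>\<open>dominates\<close>.\<close>

definition closed_nbhd :: "('a,'b) pre_digraph \<Rightarrow> 'a \<Rightarrow> 'a set" where
  "closed_nbhd G v = insert v {u. v \<rightarrow>\<^bsub>G\<^esub> u}"

definition I_set :: "('a,'b) pre_digraph \<Rightarrow> 'a set \<Rightarrow> 'a \<Rightarrow> 'a set" where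
  "I_set G S v = S \<inter> closed_nbhd G v"

definition LD_code :: "('a,'b) pre_digraph \<Rightarrow> 'a set \<Rightarrow> bool" where
  "LD_code G S \<longleftrightarrow> S \<subseteq> verts G \<and> S \<noteq> {} \<and>
     (\<forall>x \<in> verts G - S. \<forall>y \<in> verts G - S. x \<noteq> y \<longrightarrow> I_set G S x \<noteq> I_set G S y) \<and>
     (\<forall>x \<in> verts G - S. I_set G S x \<noteq> {})"

text \<open>Meaningful for finite nonempty graphs, where \<^term>\<open>verts G\<close> itself is an LD-code.\<close>

definition gamma_LD :: "('a,'b) pre_digraph \<Rightarrow> nat" where
  "gamma_LD G = (LEAST m. \<exists>S. LD_code G S \<and> card S = m)"

definition min_LD_code :: "('a,'b) pre_digraph \<Rightarrow> 'a set \<Rightarrow> bool" where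
  "min_LD_code G S \<longleftrightarrow> LD_code G S \<and> card S = gamma_LD G"

text \<open>An isolated vertex lies in every LD-code, hence is always min-forced; this is why a bound such
  as \<open>gamma_LD G \<le> card (verts G) - 3\<close> for possibly disconnected graphs needs a min-forced vertex
  that has a neighbour.\<close>

definition min_forced :: "('a,'b) pre_digraph \<Rightarrow> 'a \<Rightarrow> bool" where
  "min_forced G v \<longleftrightarrow> v \<in> verts G \<and> (\<forall>S. min_LD_code G S \<longrightarrow> v \<in> S)"

end

theory Submission
  imports Defs
begin

text \<open>
  Fix a minimum LD-code \<open>S\<close> and regard the sets \<open>I_set G S x\<close> of the vertices \<open>x\<close> outside \<open>S\<close>,
  together with the empty set, as a set \<open>\<A>\<close> of vertices of a hypercube with one coordinate for each
  code vertex. The definition of an LD-code makes these sets distinct, so \<open>\<A>\<close> has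
  \<open>n - gamma_LD G + 1\<close> elements. A cube edge in direction \<open>v\<close> inside \<open>\<A>\<close>, that is a pair
  \<open>A\<close>, \<open>insert v A\<close>, is what goes wrong when \<open>v\<close> is removed from the code: its two ends are no
  longer told apart or, if \<open>A\<close> is empty, a vertex is left without a neighbour in the code.

  The graph enters through one fact (\<open>min_forced_imp_two_cube_edges\<close>): if \<open>v\<close> is min-forced and has a
  neighbour, there are at least two cube edges in direction \<open>v\<close>. With at most one of them, \<open>v\<close> can be
  dropped, or exchanged for a vertex outside \<open>S\<close>, which yields an LD-code that avoids \<open>v\<close> and is no
  larger (\<open>LD_code_avoiding\<close>).

  The rest is about sets of hypercube vertices. If each of \<open>k\<close> directions occurs on at least two cube
  edges inside \<open>\<A>\<close>, then \<open>\<A>\<close> has at least \<open>1 + 3 * k / 2\<close> elements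
  (\<open>weighted_directions_le\<close>); squares glued together at vertices show that this is sharp. Hence
  \<open>3 * k \<le> 2 * (n - gamma_LD G)\<close>, and the bound \<open>5 * k \<le> 2 * n\<close> follows because all min-forced
  vertices lie in \<open>S\<close>, that is \<open>k \<le> gamma_LD G\<close>. Finally, cube edges in one direction are
  disjoint, so two of them already need four elements of \<open>\<A>\<close>, which gives
  \<open>n - gamma_LD G \<ge> 3\<close>.
\<close>

section \<open>Cube edges inside a set family\<close>

lemma eq_up_to_one_element:
  assumes "A - {v} = B - {v}" "A \<noteq> B"
  shows "v \<notin> B \<and> A = insert v B \<or> v \<notin> A \<and> B = insert v A"
  using assms by (cases "v \<in> A") auto

text \<open>An edge in direction \<open>v\<close> is represented by its lower end, so that the edges in one direction form
  a set family again and can be projected, counted and searched for edges themselves.\<close>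

definition cube_edges :: "'a \<Rightarrow> 'a set set \<Rightarrow> 'a set set" where
  "cube_edges v \<A> = {A \<in> \<A>. v \<notin> A \<and> insert v A \<in> \<A>}"

lemma finite_cube_edges [simp]: "finite \<A> \<Longrightarrow> finite (cube_edges v \<A>)"
  by (simp add: cube_edges_def)

text \<open>Projecting along \<open>v\<close> merges exactly the pairs of ends of the cube edges in direction \<open>v\<close>. All
  counting bounds for families are proved by such projections, one direction at a time.\<close>

lemma card_project:
  assumes "finite \<A>"
  shows "card \<A> = card ((\<lambda>A. A - {v}) ` \<A>) + card (cube_edges v \<A>)"
proof -
  let ?p = "\<lambda>A. A - {v}"
  let ?L = "{A \<in> \<A>. v \<notin> A}" and ?H = "{A \<in> \<A>. v \<in> A}"
  have fin: "finite ?L" "finite ?H"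
    using assms by auto
  have "inj_on ?p ?H"
    by (auto simp: inj_on_def)
  then have cH: "card (?p ` ?H) = card ?H"
    by (rule card_image)
  have "?p ` ?L = ?L"
    by simp
  moreover have "\<A> = ?L \<union> ?H"
    by blast
  ultimately have "?p ` \<A> = ?L \<union> ?p ` ?H"
    by (metis (no_types, lifting) image_Un)
  moreover have "?L \<inter> ?p ` ?H = cube_edges v \<A>"
  proof (intro set_eqI iffI)
    fix A assume "A \<in> ?L \<inter> ?p ` ?H"
    then show "A \<in> cube_edges v \<A>"
      by (auto simp: cube_edges_def insert_absorb)
  next
    fix A assume A: "A \<in> cube_edges v \<A>"
    then have "A = ?p (insert v A)" "insert v A \<in> ?H"
      by (auto simp: cube_edges_def)
    then show "A \<in> ?L \<inter> ?p ` ?H"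
      using A by (auto simp: cube_edges_def)
  qed
  moreover have "card \<A> = card ?L + card ?H"
  proof -
    have "\<A> = ?L \<union> ?H" "?L \<inter> ?H = {}"
      by auto
    then show ?thesis
      using card_Un_disjoint[OF fin] by simp
  qed
  ultimately show ?thesis
    using card_Un_Int[of ?L "?p ` ?H"] fin cH by simp
qed

lemma cube_edges_project:
  assumes "u \<noteq> v"
  shows "(\<lambda>A. A - {v}) ` cube_edges u \<A> \<subseteq> cube_edges u ((\<lambda>A. A - {v}) ` \<A>)"
proof
  fix B assume "B \<in> (\<lambda>A. A - {v}) ` cube_edges u \<A>"
  then obtain A where A: "A \<in> \<A>" "u \<notin> A" "insert u A \<in> \<A>" "B = A - {v}"
    by (auto simp: cube_edges_def)
  then have "insert u B = insert u A - {v}"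
    using assms by auto
  then show "B \<in> cube_edges u ((\<lambda>A. A - {v}) ` \<A>)"
    using A by (auto simp: cube_edges_def)
qed

corollary cube_edges_project_nonempty:
  assumes "u \<noteq> v" "cube_edges u \<A> \<noteq> {}"
  shows "cube_edges u ((\<lambda>A. A - {v}) ` \<A>) \<noteq> {}"
  using cube_edges_project[OF assms(1), of \<A>] assms(2) by auto

lemma two_card_cube_edges_le:
  assumes "finite \<A>"
  shows "2 * card (cube_edges v \<A>) \<le> card \<A>"
proof -
  have "cube_edges v \<A> \<subseteq> (\<lambda>A. A - {v}) ` \<A>"
    by (auto simp: cube_edges_def image_iff)
  then have "card (cube_edges v \<A>) \<le> card ((\<lambda>A. A - {v}) ` \<A>)"
    using assms by (intro card_mono) auto
  then show ?thesis
    using card_project[OF assms, of v] by simp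
qed

text \<open>This is Bondy's theorem: one edge for each occurring direction gives a forest on the family,
  since a cycle in a hypercube uses every direction an even number of times. In the induction the
  projection merges at least one pair whenever the removed direction occurs, and no other direction
  is lost.\<close>

lemma card_directions_less:
  assumes "finite F" "finite \<A>" "\<A> \<noteq> {}"
  shows "card {u \<in> F. cube_edges u \<A> \<noteq> {}} < card \<A>"
  using assms
proof (induction F arbitrary: \<A>)
  case empty
  then show ?case by (simp add: card_gt_0_iff)
next
  case (insert v F)
  let ?B = "(\<lambda>A. A - {v}) ` \<A>"
  let ?P = "\<lambda>\<A>. {u \<in> F. cube_edges u \<A> \<noteq> {}}"
  have "?P \<A> \<subseteq> ?P ?B"
  proof (intro Collect_mono impI conjI; elim conjE)
    fix u assume "u \<in> F" "cube_edges u \<A> \<noteq> {}"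
    moreover have "u \<noteq> v"
      using \<open>u \<in> F\<close> insert.hyps by blast
    ultimately show "cube_edges u ?B \<noteq> {}"
      by (intro cube_edges_project_nonempty)
  qed
  then have le: "card (?P \<A>) \<le> card (?P ?B)"
    using insert.hyps by (intro card_mono) auto
  have IH: "card (?P ?B) < card ?B"
    using insert by auto
  have m: "card \<A> = card ?B + card (cube_edges v \<A>)"
    using insert.prems by (intro card_project)
  show ?case
  proof (cases "cube_edges v \<A> = {}")
    case True
    then have "{u \<in> insert v F. cube_edges u \<A> \<noteq> {}} = ?P \<A>"
      by auto
    then show ?thesis
      using le IH m by simp
  next
    case False
    then have "{u \<in> insert v F. cube_edges u \<A> \<noteq> {}} = insert v (?P \<A>)"
      by auto
    moreover have "card (cube_edges v \<A>) > 0"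
      using False insert.prems by (simp add: card_gt_0_iff)
    ultimately show ?thesis
      using le IH m insert.hyps by simp
  qed
qed

text \<open>Projecting along \<open>v\<close> may identify edges in another direction \<open>u\<close>, but only opposite sides of a
  square with directions \<open>u\<close> and \<open>v\<close>. Such a square is a \<open>u\<close>-edge between two \<open>v\<close>-edges.\<close>

lemma collapsing_direction:
  assumes "finite \<A>" "u \<noteq> v" "card (cube_edges u \<A>) \<ge> 2"
    and "card (cube_edges u ((\<lambda>A. A - {v}) ` \<A>)) < 2"
  shows "cube_edges u (cube_edges v \<A>) \<noteq> {}"
proof -
  let ?p = "\<lambda>A. A - {v}"
  have "card (?p ` cube_edges u \<A>) < 2"
    using assms card_mono[OF _ cube_edges_project[OF assms(2), of \<A>]] by simp
  then have "\<not> inj_on ?p (cube_edges u \<A>)"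
    using assms(3) card_image[of ?p "cube_edges u \<A>"] by linarith
  then obtain A B where AB: "A \<in> cube_edges u \<A>" "B \<in> cube_edges u \<A>" "A - {v} = B - {v}" "A \<noteq> B"
    by (auto simp: inj_on_def)
  obtain C where C: "C \<in> cube_edges u \<A>" "insert v C \<in> cube_edges u \<A>" "v \<notin> C"
    using eq_up_to_one_element[OF AB(3,4)] AB(1,2) by metis
  then have "C \<in> cube_edges u (cube_edges v \<A>)"
    using assms(2) by (auto simp: cube_edges_def insert_commute)
  then show ?thesis
    by blast
qed

text \<open>Each direction has weight 0, 2 or 3 according to whether it has no edge, one edge, or at least
  two edges; keeping the middle weight is what lets the induction go through, as a projection may
  reduce two edges to one. Let the projected direction \<open>v\<close> have \<open>t\<close> edges, so that the right-hand side
  drops by \<open>2 * t\<close>. A direction that loses weight loses 1, and it occurs among the edges of the family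
  \<open>cube_edges v \<A>\<close> of size \<open>t\<close>. By Bondy's theorem at most \<open>t - 1\<close> directions do so, and with the
  weight of \<open>v\<close> the total loss is at most \<open>2 * t\<close>: it is \<open>0\<close> for \<open>t = 0\<close>, at most \<open>2\<close> for \<open>t = 1\<close>,
  and at most \<open>t - 1 + 3\<close> for \<open>t \<ge> 2\<close>.\<close>

lemma weighted_directions_le:
  assumes "finite F" "finite \<A>" "\<A> \<noteq> {}"
  shows "2 + 2 * card {u \<in> F. cube_edges u \<A> \<noteq> {}} + card {u \<in> F. card (cube_edges u \<A>) \<ge> 2}
    \<le> 2 * card \<A>"
  using assms
proof (induction F arbitrary: \<A>)
  case empty
  then have "card \<A> > 0"
    by (simp add: card_gt_0_iff)
  then show ?case by simp
next
  case (insert v F)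
  let ?B = "(\<lambda>A. A - {v}) ` \<A>"
  let ?P = "\<lambda>\<A>. {u \<in> F. cube_edges u \<A> \<noteq> {}}"
  let ?Q = "\<lambda>\<A>. {u \<in> F. card (cube_edges u \<A>) \<ge> 2}"
  let ?t = "card (cube_edges v \<A>)"
  have finB: "finite ?B"
    using insert by simp
  have IH: "2 + 2 * card (?P ?B) + card (?Q ?B) \<le> 2 * card ?B"
    using insert by auto
  have m: "card \<A> = card ?B + ?t"
    using insert.prems by (intro card_project)
  have "?P \<A> \<subseteq> ?P ?B"
  proof (intro Collect_mono impI conjI; elim conjE)
    fix u assume "u \<in> F" "cube_edges u \<A> \<noteq> {}"
    moreover have "u \<noteq> v"
      using \<open>u \<in> F\<close> insert.hyps by blast
    ultimately show "cube_edges u ?B \<noteq> {}"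
      by (intro cube_edges_project_nonempty)
  qed
  then have P: "card (?P \<A>) \<le> card (?P ?B)"
    using insert.hyps by (intro card_mono) auto
  let ?bad = "?P (cube_edges v \<A>)"
  have "?Q \<A> \<subseteq> ?Q ?B \<union> ?bad"
  proof
    fix u assume u: "u \<in> ?Q \<A>"
    then have "u \<noteq> v"
      using insert.hyps by auto
    then show "u \<in> ?Q ?B \<union> ?bad"
      using u collapsing_direction[OF insert.prems(1), of u v] by fastforce
  qed
  then have "card (?Q \<A>) \<le> card (?Q ?B \<union> ?bad)"
    using insert.hyps by (intro card_mono) auto
  then have Q: "card (?Q \<A>) \<le> card (?Q ?B) + card ?bad"
    using card_Un_le[of "?Q ?B" ?bad] by linarith
  have bad: "card ?bad \<le> ?t - 1"
  proof (cases "cube_edges v \<A> = {}")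
    case True
    have "cube_edges u (cube_edges v \<A>) = {}" for u
      unfolding True by (simp add: cube_edges_def)
    then have "?bad = {}"
      by simp
    then show ?thesis
      by (simp only: card.empty zero_le)
  next
    case False
    then show ?thesis
      using card_directions_less[OF insert.hyps(1), of "cube_edges v \<A>"] insert.prems by simp
  qed
  have "{u \<in> insert v F. cube_edges u \<A> \<noteq> {}} = (if ?t \<ge> 1 then insert v (?P \<A>) else ?P \<A>)"
    using insert.prems by (auto simp: Suc_le_eq card_gt_0_iff)
  then have P': "card {u \<in> insert v F. cube_edges u \<A> \<noteq> {}} = card (?P \<A>) + (if ?t \<ge> 1 then 1 else 0)"
    using insert.hyps by simp
  have "{u \<in> insert v F. card (cube_edges u \<A>) \<ge> 2} = (if ?t \<ge> 2 then insert v (?Q \<A>) else ?Q \<A>)"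
    by auto
  then have Q': "card {u \<in> insert v F. card (cube_edges u \<A>) \<ge> 2}
      = card (?Q \<A>) + (if ?t \<ge> 2 then 1 else 0)"
    using insert.hyps by simp
  show ?case
    unfolding P' Q' using IH m P Q bad by (auto split: if_splits)
qed

section \<open>Removing or exchanging a code vertex\<close>

lemma self_in_closed_nbhd [simp]: "v \<in> closed_nbhd G v"
  by (simp add: closed_nbhd_def)

lemma closed_nbhd_sym:
  assumes "graph G"
  shows "u \<in> closed_nbhd G v \<longleftrightarrow> v \<in> closed_nbhd G u"
proof -
  interpret graph G by fact
  show ?thesis
    using graph_symmetric by (auto simp: closed_nbhd_def)
qed

text \<open>The empty set stands for a fictitious outside vertex that sees nothing of \<open>S\<close>. With it,
  domination becomes part of separation: every vertex outside has to differ from the fictitious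
  one.\<close>

definition trace_family :: "('a,'b) pre_digraph \<Rightarrow> 'a set \<Rightarrow> 'a set set" where
  "trace_family G S = insert {} (I_set G S ` (verts G - S))"

text \<open>Remove \<open>v\<close>. A clash is a pair of vertices outside \<open>S\<close> that are no longer told apart; these, and
  outside vertices that are no longer dominated, come from cube edges in direction \<open>v\<close>, so there is
  at most one such problem. A second problem may concern \<open>v\<close> itself, which now lies outside: it may be
  undominated, or agree with a vertex \<open>u\<close>. If only one of the two problems occurs, adding a suitable
  vertex cures it.

  Suppose there is an edge with lower end \<open>A\<close>, and let \<open>a\<close> be the vertex with trace \<open>insert v A\<close> and
  \<open>b\<close>, if it exists, the vertex with trace \<open>A\<close>. Adding \<open>a\<close> cures the clash and dominates \<open>v\<close>, so it
  can only fail because \<open>v\<close> agrees with some \<open>u\<close> adjacent to \<open>a\<close>, as \<open>v\<close> is. Adding such a \<open>u\<close>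
  separates \<open>a\<close> from \<open>b\<close> or, if \<open>b\<close> does not exist, dominates \<open>a\<close>; it can only fail because \<open>b\<close> is
  \<open>u\<close> or adjacent to \<open>u\<close>. In that case adding \<open>b\<close> succeeds: \<open>b\<close> is not adjacent to \<open>v\<close>, but it is
  adjacent to the only other remaining vertex that may agree with \<open>v\<close>, which is \<open>a\<close> if \<open>b\<close> is \<open>u\<close>, and
  \<open>u\<close> otherwise.\<close>

lemma LD_code_avoiding:
  assumes G: "graph G" and S: "LD_code G S" and vS: "v \<in> S" and vw: "v \<rightarrow>\<^bsub>G\<^esub> w"
    and few: "card (cube_edges v (trace_family G S)) \<le> 1"
  obtains S' where "LD_code G S'" "v \<notin> S'" "card S' \<le> card S"
proof -
  note found = that
  interpret graph G by fact
  define U where "U = verts G - S"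
  define T where "T = S - {v}"
  define N where "N = closed_nbhd G"
  define I where "I x = S \<inter> N x" for x
  define J where "J x = T \<inter> N x" for x
  define E where "E = cube_edges v (trace_family G S)"
  have self: "x \<in> N x" for x
    by (simp add: N_def)
  have sym: "x \<in> N y \<longleftrightarrow> y \<in> N x" for x y
    using closed_nbhd_sym[OF G] by (simp add: N_def)
  have SV: "S \<subseteq> verts G"
    using S by (simp add: LD_code_def)
  then have finS: "finite S"
    by (rule finite_subset) simp
  have vU: "v \<notin> U"
    using vS by (simp add: U_def)
  have I_inj: "x = y" if "x \<in> U" "y \<in> U" "I x = I y" for x y
    using S that by (auto simp: LD_code_def I_set_def U_def I_def N_def)
  have I_ne: "I x \<noteq> {}" if "x \<in> U" for x
    using S that by (auto simp: LD_code_def I_set_def U_def I_def N_def)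
  have J_I: "J x = I x - {v}" for x
    by (auto simp: J_def I_def T_def)
  have E_iff: "A \<in> E \<longleftrightarrow> v \<notin> A \<and> (A = {} \<or> A \<in> I ` U) \<and> insert v A \<in> I ` U" for A
    by (auto simp: E_def cube_edges_def trace_family_def I_def U_def I_set_def N_def)
  have "finite E"
    by (simp add: E_def trace_family_def cube_edges_def)
  then have E_uniq: "A = B" if "A \<in> E" "B \<in> E" for A B
    using few that card_le_Suc0_iff_eq[of E] by (auto simp: E_def)
  have clash_edge: "I x' \<in> E \<and> I x = insert v (I x') \<or> I x \<in> E \<and> I x' = insert v (I x)"
    if x: "x \<in> U" "x' \<in> U" "x \<noteq> x'" "J x = J x'" for x x'
  proof -
    have ne: "I x \<noteq> I x'"
      using I_inj x by blast
    have eq: "I x - {v} = I x' - {v}"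
      using x(4) by (simp add: J_I)
    from eq ne have "v \<notin> I x' \<and> I x = insert v (I x') \<or> v \<notin> I x \<and> I x' = insert v (I x)"
      by (rule eq_up_to_one_element)
    then show ?thesis
      unfolding E_iff using x(1,2) by (metis imageI)
  qed
  have empty_edge: "{} \<in> E \<and> I x = {v}" if x: "x \<in> U" "J x = {}" for x
  proof -
    have "I x = {v}"
      using I_ne[OF x(1)] x(2) by (auto simp: J_I)
    then show ?thesis
      unfolding E_iff using x(1) by (metis empty_iff imageI)
  qed
  \<comment> \<open>A candidate \<open>y\<close> is tested only where \<open>T\<close> itself fails: on vertices with equal or empty traces.\<close>
  have exchange: thesis
    if y: "y \<in> U"
      and "\<And>x x'. \<lbrakk>x \<in> U; x' \<in> U; x \<noteq> y; x' \<noteq> y; x \<noteq> x'; J x = J x'\<rbrakk> \<Longrightarrow> (y \<in> N x) \<noteq> (y \<in> N x')"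
      and "\<And>x. \<lbrakk>x \<in> U; x \<noteq> y; J x = J v\<rbrakk> \<Longrightarrow> (y \<in> N x) \<noteq> (y \<in> N v)"
      and "\<And>x. \<lbrakk>x \<in> U; x \<noteq> y; J x = {}\<rbrakk> \<Longrightarrow> y \<in> N x"
      and "J v = {} \<Longrightarrow> y \<in> N v"
    for y
  proof (rule found)
    have out: "x = v \<or> x \<in> U \<and> x \<noteq> y" if "x \<in> verts G - insert y T" for x
      using that by (auto simp: U_def T_def)
    have split: "insert y T \<inter> N x = (if y \<in> N x then insert y (J x) else J x)" for x
      by (auto simp: J_def)
    have yT: "y \<notin> J x" for x
      using y by (auto simp: J_def T_def U_def)
    have diff: "insert y T \<inter> N x \<noteq> insert y T \<inter> N x'"
      if "J x = J x' \<Longrightarrow> (y \<in> N x) \<noteq> (y \<in> N x')" for x x'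
      using that yT[of x] yT[of x'] unfolding split by (auto simp: insert_ident split: if_splits)
    show "LD_code G (insert y T)"
      unfolding LD_code_def I_set_def N_def[symmetric]
    proof (intro conjI ballI impI)
      show "insert y T \<subseteq> verts G" "insert y T \<noteq> {}"
        using SV y by (auto simp: U_def T_def)
    next
      fix x x' assume "x \<in> verts G - insert y T" "x' \<in> verts G - insert y T" "x \<noteq> x'"
      then show "insert y T \<inter> N x \<noteq> insert y T \<inter> N x'"
        using out[of x] out[of x'] that(2)[of x x'] that(3)[of x] that(3)[of x']
        by (intro diff) metis
    next
      fix x assume "x \<in> verts G - insert y T"
      then show "insert y T \<inter> N x \<noteq> {}"
        using out[of x] that(4)[of x] that(5) unfolding split by auto
    qed
    show "v \<notin> insert y T"
      using vU y by (auto simp: T_def)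
    have "y \<notin> T"
      using y by (auto simp: T_def U_def)
    then show "card (insert y T) \<le> card S"
      using finS card_Suc_Diff1[OF finS vS] by (simp add: T_def)
  qed
  show thesis
  proof (cases "E = {}")
    case True
    then have noclash: "\<And>x x'. \<lbrakk>x \<in> U; x' \<in> U; x \<noteq> x'\<rbrakk> \<Longrightarrow> J x \<noteq> J x'"
      and nonempty: "\<And>x. x \<in> U \<Longrightarrow> J x \<noteq> {}"
      using clash_edge empty_edge by blast+
    consider u where "u \<in> U" "J u = J v" | "J v = {}" | "J v \<noteq> {}" "\<And>u. u \<in> U \<Longrightarrow> J u \<noteq> J v"
      by blast
    then show thesis
    proof cases
      case 1
      then show thesis
        using noclash nonempty by (intro exchange[of u]) metis+
    next
      case 2
      \<comment> \<open>No neighbour of \<open>v\<close> is in the code, so the given neighbour is a candidate.\<close>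
      have "w \<noteq> v"
        using vw adj_not_same by blast
      moreover have "w \<in> N v" "w \<in> verts G"
        using vw by (auto simp: N_def closed_nbhd_def)
      ultimately have "w \<in> U" "w \<in> N v"
        using 2 by (auto simp: J_def T_def U_def)
      then show thesis
        using noclash nonempty 2 by (intro exchange[of w]) metis+
    next
      case 3
      have out: "x = v \<or> x \<in> U" if "x \<in> verts G - T" for x
        using that by (auto simp: U_def T_def)
      have "LD_code G T"
        unfolding LD_code_def I_set_def N_def[symmetric] J_def[symmetric]
      proof (intro conjI ballI impI)
        show "T \<subseteq> verts G" "T \<noteq> {}"
          using SV 3(1) by (auto simp: T_def J_def)
      next
        fix x x' assume "x \<in> verts G - T" "x' \<in> verts G - T" "x \<noteq> x'"
        then show "J x \<noteq> J x'"
          using out[of x] out[of x'] 3(2) noclash by metis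
      next
        fix x assume "x \<in> verts G - T"
        then show "J x \<noteq> {}"
          using out[of x] 3(1) nonempty by metis
      qed
      moreover have "card T \<le> card S"
        using finS by (auto simp: T_def intro: card_mono)
      ultimately show thesis
        using found by (simp add: T_def)
    qed
  next
    case False
    then obtain A where A: "A \<in> E"
      by blast
    then obtain a where a: "a \<in> U" "I a = insert v A" and vA: "v \<notin> A"
      unfolding E_iff by auto
    have av: "a \<in> N v"
      using a(2) sym by (auto simp: I_def)
    have clash: "x = a \<and> I x' = A \<or> x' = a \<and> I x = A"
      if "x \<in> U" "x' \<in> U" "x \<noteq> x'" "J x = J x'" for x x'
      using clash_edge[OF that] E_uniq[OF _ A] I_inj a that by metis
    have empty: "x = a \<and> A = {}" if "x \<in> U" "J x = {}" for x
      using empty_edge[OF that] E_uniq[OF _ A] I_inj a that by metis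
    show thesis
    proof (cases "\<exists>u \<in> U. u \<noteq> a \<and> J u = J v \<and> a \<in> N u")
      case False
      then show thesis
        using a av clash empty by (intro exchange[of a]) metis+
    next
      case True
      then obtain u where u: "u \<in> U" "u \<noteq> a" "J u = J v" "u \<in> N a"
        using sym by blast
      have Jv: "J v \<noteq> {}"
        using empty u by metis
      show thesis
      proof (cases "\<exists>b \<in> U. I b = A \<and> b \<in> N u")
        case False
        then have far: "u \<notin> N b" if "b \<in> U" "I b = A" for b
          using that sym by blast
        show thesis
        proof (rule exchange[OF u(1)])
          fix x x' assume x: "x \<in> U" "x' \<in> U" "x \<noteq> x'" "J x = J x'"
          then show "(u \<in> N x) \<noteq> (u \<in> N x')"
            using clash[OF x] far u(4) by metis
        next
          fix x assume x: "x \<in> U" "x \<noteq> u" "J x = J v"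
          then show "(u \<in> N x) \<noteq> (u \<in> N v)"
            using clash[of x u] far u self by metis
        next
          fix x assume x: "x \<in> U" "J x = {}"
          then show "u \<in> N x"
            using empty u by metis
        next
          assume "J v = {}"
          then show "u \<in> N v"
            using Jv by blast
        qed
      next
        case True
        then obtain b where b: "b \<in> U" "I b = A" "b \<in> N u"
          by blast
        have bv: "b \<notin> N v"
          using b(2) vA vS sym by (auto simp: I_def)
        show thesis
        proof (rule exchange[OF b(1)])
          fix x x' assume x: "x \<in> U" "x' \<in> U" "x \<noteq> b" "x' \<noteq> b" "x \<noteq> x'" "J x = J x'"
          then show "(b \<in> N x) \<noteq> (b \<in> N x')"
            using clash[of x x'] b I_inj by metis
        next
          fix x assume x: "x \<in> U" "x \<noteq> b" "J x = J v"
          have "b \<in> N x"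
          proof (cases "x = u")
            case False
            then have "x = a" "u = b"
              using clash[of x u] x u b I_inj by metis+
            then show ?thesis
              using u(4) by simp
          qed (use b in simp)
          then show "(b \<in> N x) \<noteq> (b \<in> N v)"
            using bv by blast
        next
          fix x assume x: "x \<in> U" "J x = {}"
          then show "b \<in> N x"
            using empty b I_ne by metis
        next
          assume "J v = {}"
          then show "b \<in> N v"
            using Jv by blast
        qed
      qed
    qed
  qed
qed

section \<open>Counting min-forced vertices\<close>

lemma gamma_LD_le: "LD_code G S \<Longrightarrow> gamma_LD G \<le> card S"
  unfolding gamma_LD_def by (rule Least_le) blast

lemma min_LD_code_exists:
  assumes "verts G \<noteq> {}"
  obtains S where "min_LD_code G S"
proof -
  have "LD_code G (verts G)"
    using assms by (simp add: LD_code_def)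
  then have "\<exists>S. LD_code G S \<and> card S = card (verts G)"
    by blast
  then have "\<exists>S. LD_code G S \<and> card S = gamma_LD G"
    unfolding gamma_LD_def by (rule LeastI)
  then show thesis
    using that by (auto simp: min_LD_code_def)
qed

text \<open>The neighbour cannot be dispensed with: an isolated vertex is in every LD-code although no
  \<open>I_set\<close> of another vertex contains it.\<close>

lemma min_forced_imp_two_cube_edges:
  assumes "graph G" "min_LD_code G S" "min_forced G v" "v \<rightarrow>\<^bsub>G\<^esub> w"
  shows "card (cube_edges v (trace_family G S)) \<ge> 2"
proof (rule ccontr)
  assume "\<not> ?thesis"
  then have few: "card (cube_edges v (trace_family G S)) \<le> 1"
    by simp
  have LD: "LD_code G S" and vS: "v \<in> S" and cS: "card S = gamma_LD G"
    using assms(2,3) by (auto simp: min_LD_code_def min_forced_def)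
  obtain S' where S': "LD_code G S'" "v \<notin> S'" "card S' \<le> gamma_LD G"
    using LD_code_avoiding[OF assms(1) LD vS assms(4) few] cS by metis
  then have "min_LD_code G S'"
    using gamma_LD_le[of G S'] by (simp add: min_LD_code_def)
  then show False
    using S'(2) assms(3) by (simp add: min_forced_def)
qed

lemma card_trace_family:
  assumes "finite (verts G)" "LD_code G S"
  shows "card (trace_family G S) = Suc (card (verts G - S))"
proof -
  have "inj_on (I_set G S) (verts G - S)" "{} \<notin> I_set G S ` (verts G - S)"
    using assms(2) by (auto simp: LD_code_def inj_on_def)
  then show ?thesis
    using assms(1) by (simp add: trace_family_def card_image)
qed

lemma connected_imp_neighbour:
  assumes "graph G" "Digraph_Component.connected G" "card (verts G) \<ge> 2" "v \<in> verts G"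
  obtains w where "v \<rightarrow>\<^bsub>G\<^esub> w"
proof -
  interpret graph G by fact
  have "verts G \<noteq> {v}"
    using assms(3) by auto
  then obtain u where u: "u \<in> verts G" "u \<noteq> v"
    using assms(4) by blast
  then have "v \<rightarrow>\<^sup>*\<^bsub>G\<^esub> u"
    using symmetric_connected_imp_strongly_connected[OF sym_arcs assms(2)] assms(4) by blast
  then show thesis
    using u(2) that by (cases rule: converse_reachable_cases) auto
qed

theorem theorem3p9:
  fixes G :: "('a,'b) pre_digraph" and n k :: nat
  assumes "graph G"
    and "n = card (verts G)" and "n \<ge> 2"
    and "k = card {v \<in> verts G. min_forced G v}" and "k \<ge> 1"
  shows "(Digraph_Component.connected G \<longrightarrow>
            real k \<le> 2 / 3 * (real n - real (gamma_LD G)) \<and>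
            real k \<le> 2 / 5 * real n) \<and>
         ((\<exists>v u. min_forced G v \<and> v \<rightarrow>\<^bsub>G\<^esub> u) \<longrightarrow>
            real (gamma_LD G) \<le> real n - 3)"
proof -
  interpret graph G by fact
  let ?F = "{v \<in> verts G. min_forced G v}"
  have fin: "finite (verts G)"
    by simp
  obtain S where S: "min_LD_code G S"
    using assms(2,3) by (metis card.empty min_LD_code_exists not_numeral_le_zero)
  then have LD: "LD_code G S" and cS: "card S = gamma_LD G" and SV: "S \<subseteq> verts G"
    by (auto simp: min_LD_code_def LD_code_def)
  let ?A = "trace_family G S"
  have finA: "finite ?A" and neA: "?A \<noteq> {}"
    by (auto simp: trace_family_def)
  have n: "card (verts G - S) + gamma_LD G = n"
    using cS SV fin assms(2) by (metis add.commute card_Diff_subset card_mono finite_subset le_add_diff_inverse)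
  then have cA: "card ?A + gamma_LD G = n + 1"
    using card_trace_family[OF fin LD] by simp
  have conn: "3 * k \<le> 2 * (n - gamma_LD G) \<and> 5 * k \<le> 2 * n" if "Digraph_Component.connected G"
  proof -
    have two: "card (cube_edges v ?A) \<ge> 2" if "v \<in> ?F" for v
      using connected_imp_neighbour[OF assms(1) \<open>Digraph_Component.connected G\<close>, of v]
        min_forced_imp_two_cube_edges[OF assms(1) S, of v] assms(2,3) that by blast
    then have "{v \<in> ?F. card (cube_edges v ?A) \<ge> 2} = ?F"
      by auto
    moreover have "{v \<in> ?F. cube_edges v ?A \<noteq> {}} = ?F"
      using two by fastforce
    ultimately have "2 + 3 * k \<le> 2 * card ?A"
      using weighted_directions_le[OF _ finA neA, of ?F] assms(4) by simp
    then have le: "3 * k \<le> 2 * (n - gamma_LD G)"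
      using cA by linarith
    have "?F \<subseteq> S"
      using S by (auto simp: min_forced_def)
    then have "k \<le> gamma_LD G"
      using assms(4) cS SV fin by (metis card_mono finite_subset)
    then show ?thesis
      using le n by linarith
  qed
  have "real (gamma_LD G) \<le> real n - 3" if "min_forced G v" "v \<rightarrow>\<^bsub>G\<^esub> u" for v u
    using min_forced_imp_two_cube_edges[OF assms(1) S that] two_card_cube_edges_le[OF finA, of v] cA
    by linarith
  moreover have "real k \<le> 2 / 3 * (real n - real (gamma_LD G)) \<and> real k \<le> 2 / 5 * real n"
    if "Digraph_Component.connected G"
  proof -
    have "3 * k + 2 * gamma_LD G \<le> 2 * n" "5 * k \<le> 2 * n"
      using conn[OF that] n by linarith+
    then have "3 * real k + 2 * real (gamma_LD G) \<le> 2 * real n" "5 * real k \<le> 2 * real n"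
      by linarith+
    then show ?thesis
      by simp
  qed
  ultimately show ?thesis
    by blast
qed

end
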